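(* Let $G_{0}=(V,E)$ be an equitably $l$-colorable graph with a spanning subgraph $Z_{0}$ such that $\delta(Z_{0})\geq 1$, and $|E(Z_{0})|\geq |V|-1$ when $\delta(G_{0})=1$. Then there is an equitably $l$-colorable graph $G\in \mathcal{R}(\pi(G_{0}),G_{0}-E(Z_{0}))$ such that $G$ is $(\delta(G)-1)$-edge-connected when $\delta(G)\geq 3$ and $\delta(G)$ is odd, and $G$ is maximally edge-connected otherwise.
   Context: All graphs are finite and simple. $\delta(\cdot)$ denotes minimum degree. A (proper) coloring with $l$ colors is equitable if its color classes pairwise differ in size by at most one. $\pi(G_0)$ is the degree sequence of $G_0$; for a subgraph $Z$ of $G_0$, $\mathcal{R}(\pi(G_0),Z)$ is the set of graphs $W$ on vertex set $V$ with $\deg_W(v)=\deg_{G_0}(v)$ for all $v$ and $E(Z)\subseteq E(W)$. A graph is $t$-edge-connected if it remains connected after deleting any fewer than $t$ edges; it is maximally edge-connected if its edge-connectivity equals its minimum degree. *)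

theory Defs
  imports Main
begin

text \<open>
  A finite simple graph is given by its vertex set \<open>V\<close> and its set \<open>E\<close> of edges, the edges being
  two-element subsets of \<open>V\<close>. Graphs are nonempty, as the minimum degree is a minimum over \<open>V\<close>.
\<close>

definition simple_graph :: "'a set \<Rightarrow> 'a set set \<Rightarrow> bool" where
  "simple_graph V E \<longleftrightarrow> finite V \<and> V \<noteq> {} \<and> (\<forall>e\<in>E. e \<subseteq> V \<and> card e = 2)"

definition degree :: "'a set set \<Rightarrow> 'a \<Rightarrow> nat" where
  "degree E v = card {e \<in> E. v \<in> e}"

definition min_degree :: "'a set \<Rightarrow> 'a set set \<Rightarrow> nat" where
  "min_degree V E = Min (degree E ` V)"

definition graph_connected :: "'a set \<Rightarrow> 'a set set \<Rightarrow> bool" where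
  "graph_connected V E \<longleftrightarrow> (\<forall>u\<in>V. \<forall>v\<in>V. (u, v) \<in> {(x, y). {x, y} \<in> E}\<^sup>*)"

definition edge_connected :: "nat \<Rightarrow> 'a set \<Rightarrow> 'a set set \<Rightarrow> bool" where
  "edge_connected t V E \<longleftrightarrow> (\<forall>F\<subseteq>E. card F < t \<longrightarrow> graph_connected V (E - F))"

text \<open>
  Every graph is 0-edge-connected, and on at least two vertices deleting all edges disconnects, so
  the maximum below is over a finite nonempty set. It is meaningless on a single vertex.
\<close>

definition edge_connectivity :: "'a set \<Rightarrow> 'a set set \<Rightarrow> nat" where
  "edge_connectivity V E = Max {t. edge_connected t V E}"

definition maximally_edge_connected :: "'a set \<Rightarrow> 'a set set \<Rightarrow> bool" where
  "maximally_edge_connected V E \<longleftrightarrow> edge_connectivity V E = min_degree V E"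

text \<open>The colors are \<open>0, \<dots>, l - 1\<close>; unused colors count as (empty) color classes.\<close>

definition color_class :: "'a set \<Rightarrow> ('a \<Rightarrow> nat) \<Rightarrow> nat \<Rightarrow> 'a set" where
  "color_class V c i = {v \<in> V. c v = i}"

definition proper_coloring :: "nat \<Rightarrow> 'a set \<Rightarrow> 'a set set \<Rightarrow> ('a \<Rightarrow> nat) \<Rightarrow> bool" where
  "proper_coloring l V E c \<longleftrightarrow>
     (\<forall>v\<in>V. c v < l) \<and> (\<forall>u v. {u, v} \<in> E \<longrightarrow> c u \<noteq> c v)"

definition equitable :: "nat \<Rightarrow> 'a set \<Rightarrow> ('a \<Rightarrow> nat) \<Rightarrow> bool" where
  "equitable l V c \<longleftrightarrow>
     (\<forall>i<l. \<forall>j<l. card (color_class V c i) \<le> card (color_class V c j) + 1)"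

definition equitably_colorable :: "nat \<Rightarrow> 'a set \<Rightarrow> 'a set set \<Rightarrow> bool" where
  "equitably_colorable l V E \<longleftrightarrow> (\<exists>c. proper_coloring l V E c \<and> equitable l V c)"

text \<open>
  \<open>realizations V d F\<close>: the edge sets of the graphs on \<open>V\<close> in which each vertex \<open>v\<close> has the
  prescribed degree \<open>d v\<close> and which contain all edges in \<open>F\<close>. The degree sequence is thus indexed
  by the vertices.
\<close>

definition realizations :: "'a set \<Rightarrow> ('a \<Rightarrow> nat) \<Rightarrow> 'a set set \<Rightarrow> 'a set set set" where
  "realizations V d F = {W. simple_graph V W \<and> (\<forall>v\<in>V. degree W v = d v) \<and> F \<subseteq> W}"

end

theory Submission imports Defs begin

text \<open>
  Fix an equitable coloring \<open>col\<close> of \<open>G0\<close> and put \<open>F = G0 - Z0\<close>. Let \<open>k\<close> be the required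
  edge-connectivity, so \<open>k\<close> is even or \<open>k = 1\<close>. Among the realizations \<open>G \<supseteq> F\<close> that are properly
  colored by \<open>col\<close>, one minimizes the total deficiency of the cuts with fewer than \<open>k\<close> edges; as
  long as it is positive, exchanging edges of \<open>G - F\<close> lowers it.

  For even \<open>k\<close>, let \<open>X\<close> be inclusion-minimal with \<open>d(X) < k\<close> and \<open>Y\<close> likewise in the complement of
  \<open>X\<close>. If \<open>S\<close> splits \<open>X\<close>, then \<open>2 k \<le> d(X \<inter> S) + d(X - S) = 2 p + d(X)\<close>, where \<open>p\<close> counts the edges
  inside \<open>X\<close> cut by \<open>S\<close>; parity gives \<open>p \<ge> k / 2 + 1\<close>. A set splitting both \<open>X\<close> and \<open>Y\<close> thus has
  \<open>d(S) \<ge> k + 2\<close>, and only such sets can lose edges in an exchange of edges \<open>ab\<close> inside \<open>X\<close> and \<open>cd\<close>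
  inside \<open>Y\<close> for edges between \<open>X\<close> and \<open>Y\<close>, where a single switch costs at most two.
  Such a switch exists with \<open>a\<close> and \<open>c\<close> interior to \<open>X\<close> and \<open>Y\<close> (no neighbors outside) unless
  \<open>bd\<close> is an edge and the colors conflict. The interiors of \<open>X\<close> and \<open>Y\<close> are not monochromatic; if all
  four pairs from two differently colored interior vertices on each side are blocked, the colors
  are so restricted that switching all four edges along an 8-cycle is possible. It costs at most four
  edges, and four only for sets \<open>S\<close> cutting additionally the edges \<open>bd\<close>, \<open>b'd'\<close>.

  For \<open>k = 1\<close> and \<open>G\<close> disconnected, \<open>card Z0 \<ge> card V - 1\<close> forces an edge of \<open>G - F\<close> that is not a
  bridge, and switching it with an edge of another component connects the two.
\<close>

section \<open>Cuts and degrees under exchanges of edges\<close>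

definition cut_edges :: "'a set set \<Rightarrow> 'a set \<Rightarrow> 'a set set" where
  "cut_edges E S = {e \<in> E. e \<inter> S \<noteq> {} \<and> \<not> e \<subseteq> S}"

lemma doubleton_in_cut_edges: "{u, v} \<in> cut_edges E S \<longleftrightarrow> {u, v} \<in> E \<and> (u \<in> S) \<noteq> (v \<in> S)"
  by (auto simp: cut_edges_def)

lemma finite_cut_edges: "finite E \<Longrightarrow> finite (cut_edges E S)"
  by (simp add: cut_edges_def)

lemma simple_graph_finite: "simple_graph V E \<Longrightarrow> finite E"
  unfolding simple_graph_def by (meson Pow_iff finite_Pow_iff finite_subset subsetI)

lemma simple_graph_edge:
  assumes "simple_graph V E" "e \<in> E"
  obtains u v where "e = {u, v}" "u \<noteq> v" "u \<in> V" "v \<in> V"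
  using assms unfolding simple_graph_def card_2_iff by (metis insert_subset)

lemma simple_graph_doubleton:
  assumes "simple_graph V E" "{u, v} \<in> E"
  shows "u \<noteq> v" "u \<in> V" "v \<in> V"
  using assms unfolding simple_graph_def by fastforce+

lemma cut_edges_complement:
  assumes "simple_graph V E"
  shows "cut_edges E (V - S) = cut_edges E S"
proof -
  have "e \<inter> (V - S) \<noteq> {} \<and> \<not> e \<subseteq> V - S \<longleftrightarrow> e \<inter> S \<noteq> {} \<and> \<not> e \<subseteq> S" if "e \<in> E" for e
    using assms that unfolding simple_graph_def by blast
  then show ?thesis unfolding cut_edges_def by blast
qed

text \<open>With \<open>P\<close> read as "cut by \<open>S\<close>", "incident with
  \<open>v\<close>" or true, this yields the balances of cuts, degrees and edge numbers alike. The
  additive form avoids truncated subtraction.\<close>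

lemma card_filter_exchange:
  assumes "finite G" "D \<subseteq> G" "finite A" "A \<inter> G = {}"
  shows "card {e \<in> G - D \<union> A. P e} + card {e \<in> D. P e} = card {e \<in> G. P e} + card {e \<in> A. P e}"
proof -
  have "{e \<in> G - D \<union> A. P e} = {e \<in> G - D. P e} \<union> {e \<in> A. P e}" by blast
  moreover have "card \<dots> = card {e \<in> G - D. P e} + card {e \<in> A. P e}"
    by (rule card_Un_disjoint) (use assms in auto)
  moreover have "{e \<in> G. P e} = {e \<in> G - D. P e} \<union> {e \<in> D. P e}" using assms by blast
  moreover have "card \<dots> = card {e \<in> G - D. P e} + card {e \<in> D. P e}"
    by (rule card_Un_disjoint) (use assms finite_subset[of D G] in auto)
  ultimately show ?thesis by simp
qed

text \<open>Together with \<open>degree_insert\<close>, this turns cuts and degrees of explicitly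
  listed edge sets into sums of indicators, so that a switch is verified by running through the
  positions of its vertices.\<close>

lemma card_cut_edges_insert:
  assumes "finite E" "{u, v} \<notin> E"
  shows "card (cut_edges (insert {u, v} E) S) = of_bool ((u \<in> S) \<noteq> (v \<in> S)) + card (cut_edges E S)"
proof -
  have "cut_edges (insert {u, v} E) S = (if (u \<in> S) \<noteq> (v \<in> S) then insert {u, v} (cut_edges E S) else cut_edges E S)"
    unfolding cut_edges_def by auto
  moreover have "{u, v} \<notin> cut_edges E S" using assms by (simp add: cut_edges_def)
  ultimately show ?thesis using assms by (simp add: finite_cut_edges)
qed

lemma cut_edges_empty [simp]: "cut_edges {} S = {}"
  by (simp add: cut_edges_def)

lemma degree_insert:
  assumes "finite E" "{u, v} \<notin> E" "u \<noteq> v"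
  shows "degree (insert {u, v} E) w = of_bool (w = u) + of_bool (w = v) + degree E w"
proof -
  have "{e \<in> insert {u, v} E. w \<in> e} =
      (if w = u \<or> w = v then insert {u, v} {e \<in> E. w \<in> e} else {e \<in> E. w \<in> e})"
    by auto
  then show ?thesis using assms by (simp add: degree_def)
qed

lemma degree_empty [simp]: "degree {} v = 0"
  by (simp add: degree_def)

section \<open>Deficiency and edge switches\<close>

definition deficiency :: "'a set \<Rightarrow> nat \<Rightarrow> 'a set set \<Rightarrow> nat" where
  "deficiency V k G = (\<Sum>S \<in> Pow V - {{}, V}. k - card (cut_edges G S))"

text \<open>The condition \<open>card G = m\<close> follows from the degrees, but is kept to avoid the handshake lemma.\<close>

definition admissible ::
  "'a set \<Rightarrow> 'a set set \<Rightarrow> ('a \<Rightarrow> nat) \<Rightarrow> ('a \<Rightarrow> nat) \<Rightarrow> nat \<Rightarrow> 'a set set \<Rightarrow> bool" where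
  "admissible V F col dg m G \<longleftrightarrow> simple_graph V G \<and> F \<subseteq> G \<and> (\<forall>v\<in>V. degree G v = dg v) \<and>
     (\<forall>u v. {u, v} \<in> G \<longrightarrow> col u \<noteq> col v) \<and> card G = m"

text \<open>By \<open>cuts\<close>, a cut may lose edges only if at least \<open>k\<close> remain,
  and then its truncated term is 0. So no term of the deficiency grows, while the positive term of
  \<open>X\<close> shrinks.\<close>

lemma exchange_reduces_deficiency:
  assumes adm: "admissible V F col dg m G"
    and D: "D \<subseteq> G - F"
    and A: "finite A" "A \<inter> G = {}" "\<And>e. e \<in> A \<Longrightarrow> e \<subseteq> V \<and> card e = 2"
    and col: "\<And>u v. {u, v} \<in> A \<Longrightarrow> col u \<noteq> col v"
    and card: "card A = card D"
    and deg: "\<And>v. v \<in> V \<Longrightarrow> degree A v = degree D v"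
    and cuts: "\<And>S. S \<subseteq> V \<Longrightarrow> card (cut_edges D S) \<le> card (cut_edges A S) \<or>
                 k + card (cut_edges D S) \<le> card (cut_edges G S) + card (cut_edges A S)"
    and X: "X \<subseteq> V" "X \<noteq> {}" "X \<noteq> V" "card (cut_edges G X) < k" "card (cut_edges D X) < card (cut_edges A X)"
  shows "\<exists>G'. admissible V F col dg m G' \<and> deficiency V k G' < deficiency V k G"
proof -
  define G' where "G' = G - D \<union> A"
  have sg: "simple_graph V G" and FG: "F \<subseteq> G" using adm by (auto simp: admissible_def)
  have fin: "finite G" using sg by (rule simple_graph_finite)
  have DG: "D \<subseteq> G" using D by blast
  have deg': "degree G' v + degree D v = degree G v + degree A v" for v
    unfolding degree_def G'_def using fin DG A(1,2) by (rule card_filter_exchange)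
  have cut': "card (cut_edges G' S) + card (cut_edges D S) = card (cut_edges G S) + card (cut_edges A S)" for S
    unfolding cut_edges_def G'_def using fin DG A(1,2) by (rule card_filter_exchange)
  have "card G' + card D = card G + card A"
    unfolding G'_def using card_filter_exchange[OF fin DG A(1,2), of "\<lambda>_. True"]
    by (simp only: simp_thms Collect_mem_eq)
  then have cardG': "card G' = card G" using card by simp
  have "admissible V F col dg m G'"
    unfolding admissible_def
  proof (intro conjI)
    show "simple_graph V G'" using sg A(3) unfolding simple_graph_def G'_def by blast
    show "F \<subseteq> G'" using FG D unfolding G'_def by blast
    show "\<forall>v\<in>V. degree G' v = dg v" using adm deg' deg unfolding admissible_def
      by (metis add_right_cancel)
    show "\<forall>u v. {u, v} \<in> G' \<longrightarrow> col u \<noteq> col v"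
      using adm col unfolding admissible_def G'_def by blast
    show "card G' = m" using adm cardG' by (simp add: admissible_def)
  qed
  moreover have "deficiency V k G' < deficiency V k G"
    unfolding deficiency_def
  proof (rule sum_strict_mono_ex1)
    show "finite (Pow V - {{}, V})" using sg by (simp add: simple_graph_def)
    show "\<forall>S\<in>Pow V - {{}, V}. k - card (cut_edges G' S) \<le> k - card (cut_edges G S)"
    proof
      fix S assume "S \<in> Pow V - {{}, V}"
      then have "S \<subseteq> V" by simp
      then have "k \<le> card (cut_edges G' S) \<or> card (cut_edges G S) \<le> card (cut_edges G' S)"
        using cuts[of S] cut'[of S] by linarith
      then show "k - card (cut_edges G' S) \<le> k - card (cut_edges G S)" by (auto intro: diff_le_mono2)
    qed
    show "\<exists>S\<in>Pow V - {{}, V}. k - card (cut_edges G' S) < k - card (cut_edges G S)"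
      using X cut'[of X] by (intro bexI[of _ X]) auto
  qed
  ultimately show ?thesis by blast
qed

text \<open>If \<open>S\<close> separates at most one of the pairs \<open>a\<close>,
  \<open>b\<close> and \<open>c\<close>, \<open>d\<close>, no cut edge is lost. If it separates
  both, at most two are lost, which \<open>sep\<close> allows. The cut of \<open>X\<close> gains
  two.\<close>

lemma two_switch:
  assumes adm: "admissible V F col dg m G"
    and edges: "{a, b} \<in> G - F" "{c, d} \<in> G - F"
    and X: "a \<in> X" "b \<in> X" "c \<notin> X" "d \<notin> X" "X \<subseteq> V" "card (cut_edges G X) < k"
    and new: "{a, c} \<notin> G" "{b, d} \<notin> G" "col a \<noteq> col c" "col b \<noteq> col d"
    and sep: "\<And>S. S \<subseteq> V \<Longrightarrow> (a \<in> S) \<noteq> (b \<in> S) \<Longrightarrow> (c \<in> S) \<noteq> (d \<in> S) \<Longrightarrow>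
                 k + 2 \<le> card (cut_edges G S)"
  shows "\<exists>G'. admissible V F col dg m G' \<and> deficiency V k G' < deficiency V k G"
proof -
  have sg: "simple_graph V G" using adm by (simp add: admissible_def)
  note ab = simple_graph_doubleton[OF sg, of a b] and cd = simple_graph_doubleton[OF sg, of c d]
  have neq: "a \<noteq> b" "c \<noteq> d" "a \<noteq> c" "a \<noteq> d" "b \<noteq> c" "b \<noteq> d" and V: "c \<in> V" "d \<in> V"
    using ab cd edges X by auto
  have ne: "{a, b} \<noteq> {c, d}" "{a, c} \<noteq> {b, d}" using neq by (auto simp: doubleton_eq_iff)
  show ?thesis
  proof (rule exchange_reduces_deficiency[where D = "{{a, b}, {c, d}}" and A = "{{a, c}, {b, d}}"
        and X = X])
    show "card (cut_edges {{a, b}, {c, d}} S) \<le> card (cut_edges {{a, c}, {b, d}} S) \<or>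
      k + card (cut_edges {{a, b}, {c, d}} S) \<le> card (cut_edges G S) + card (cut_edges {{a, c}, {b, d}} S)"
      if "S \<subseteq> V" for S
      using sep[OF that] ne
      by (cases "a \<in> S"; cases "b \<in> S"; cases "c \<in> S"; cases "d \<in> S"; simp add: card_cut_edges_insert)
    show "card (cut_edges {{a, b}, {c, d}} X) < card (cut_edges {{a, c}, {b, d}} X)"
      using ne X by (simp add: card_cut_edges_insert)
    show "degree {{a, c}, {b, d}} v = degree {{a, b}, {c, d}} v" for v
      using ne neq by (simp add: degree_insert)
    show "card {{a, c}, {b, d}} = card {{a, b}, {c, d}}" using ne by simp
  qed (use adm edges X new V neq in \<open>auto simp: doubleton_eq_iff\<close>)
qed

text \<open>The old and new edges alternate along the 8-cycle \<open>a b c d a' b' c' d'\<close>. A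
  cycle crosses a cut an even number of times, so a loss is 2 or 4. A loss of 4 needs all old edges
  cut and no new one; then \<open>b\<close>, \<open>c\<close>, \<open>b'\<close>, \<open>c'\<close>
  lie opposite to \<open>d\<close>, \<open>a'\<close>, \<open>d'\<close>, \<open>a\<close>, which is
  why the extra 2 in \<open>sep\<close> is requested only for such sets.\<close>

lemma four_switch:
  assumes adm: "admissible V F col dg m G"
    and edges: "{a, b} \<in> G - F" "{c, d} \<in> G - F" "{a', b'} \<in> G - F" "{c', d'} \<in> G - F"
    and X: "a \<in> X" "b \<in> X" "a' \<in> X" "b' \<in> X" "X \<subseteq> V" "card (cut_edges G X) < k"
    and Y: "c \<in> Y" "d \<in> Y" "c' \<in> Y" "d' \<in> Y" "Y \<inter> X = {}"
    and dist: "distinct [a, b, a', b']" "distinct [c, d, c', d']"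
    and new: "{b, c} \<notin> G" "{d, a'} \<notin> G" "{b', c'} \<notin> G" "{d', a} \<notin> G"
    and col: "col b \<noteq> col c" "col d \<noteq> col a'" "col b' \<noteq> col c'" "col d' \<noteq> col a"
    and sep: "\<And>S. S \<subseteq> V \<Longrightarrow> X \<inter> S \<noteq> {} \<Longrightarrow> X - S \<noteq> {} \<Longrightarrow> Y \<inter> S \<noteq> {} \<Longrightarrow> Y - S \<noteq> {} \<Longrightarrow>
       k + 2 + (if (b \<in> S) \<noteq> (d \<in> S) \<and> (b' \<in> S) \<noteq> (d' \<in> S) then 2 else 0) \<le> card (cut_edges G S)"
  shows "\<exists>G'. admissible V F col dg m G' \<and> deficiency V k G' < deficiency V k G"
proof -
  have sg: "simple_graph V G" using adm by (simp add: admissible_def)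
  have V: "a \<in> V" "b \<in> V" "c \<in> V" "d \<in> V" "a' \<in> V" "b' \<in> V" "c' \<in> V" "d' \<in> V"
    using edges simple_graph_doubleton[OF sg] by blast+
  have out: "c \<notin> X" "d \<notin> X" "c' \<notin> X" "d' \<notin> X" using Y by auto
  have neq: "distinct [a, b, a', b', c, d, c', d']" using dist out X by auto
  let ?D = "{{a, b}, {c, d}, {a', b'}, {c', d'}}"
  let ?A = "{{b, c}, {d, a'}, {b', c'}, {d', a}}"
  have ne: "{a, b} \<notin> {{c, d}, {a', b'}, {c', d'}}" "{c, d} \<notin> {{a', b'}, {c', d'}}"
    "{a', b'} \<noteq> {c', d'}" "{b, c} \<notin> {{d, a'}, {b', c'}, {d', a}}"
    "{d, a'} \<notin> {{b', c'}, {d', a}}" "{b', c'} \<noteq> {d', a}"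
    using neq by (auto simp: doubleton_eq_iff)
  have cutD: "card (cut_edges ?D S) = of_bool ((a \<in> S) \<noteq> (b \<in> S)) + of_bool ((c \<in> S) \<noteq> (d \<in> S))
      + of_bool ((a' \<in> S) \<noteq> (b' \<in> S)) + of_bool ((c' \<in> S) \<noteq> (d' \<in> S))" for S
    using ne by (simp add: card_cut_edges_insert)
  have cutA: "card (cut_edges ?A S) = of_bool ((b \<in> S) \<noteq> (c \<in> S)) + of_bool ((d \<in> S) \<noteq> (a' \<in> S))
      + of_bool ((b' \<in> S) \<noteq> (c' \<in> S)) + of_bool ((d' \<in> S) \<noteq> (a \<in> S))" for S
    using ne by (simp add: card_cut_edges_insert)
  have ends: "a \<noteq> b" "c \<noteq> d" "a' \<noteq> b'" "c' \<noteq> d'" "b \<noteq> c" "d \<noteq> a'" "b' \<noteq> c'" "d' \<noteq> a"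
    using neq by auto
  have degD: "degree ?D v = of_bool (v = a) + of_bool (v = b) + of_bool (v = c) + of_bool (v = d)
      + of_bool (v = a') + of_bool (v = b') + of_bool (v = c') + of_bool (v = d')" for v
    using ne ends by (simp add: degree_insert)
  have degA: "degree ?A v = of_bool (v = b) + of_bool (v = c) + of_bool (v = d) + of_bool (v = a')
      + of_bool (v = b') + of_bool (v = c') + of_bool (v = d') + of_bool (v = a)" for v
    using ne ends by (simp add: degree_insert)
  show ?thesis
  proof (rule exchange_reduces_deficiency[where D = ?D and A = ?A and X = X])
    show "card (cut_edges ?D S) \<le> card (cut_edges ?A S) \<or>
      k + card (cut_edges ?D S) \<le> card (cut_edges G S) + card (cut_edges ?A S)" if "S \<subseteq> V" for S
    proof -
      consider "X \<inter> S = {} \<or> X - S = {}" | "Y \<inter> S = {} \<or> Y - S = {}"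
        | "X \<inter> S \<noteq> {}" "X - S \<noteq> {}" "Y \<inter> S \<noteq> {}" "Y - S \<noteq> {}" by blast
      then show ?thesis
      proof cases
        case 1
        then have "b \<in> S \<longleftrightarrow> a \<in> S" "a' \<in> S \<longleftrightarrow> a \<in> S" "b' \<in> S \<longleftrightarrow> a \<in> S" using X by blast+
        then show ?thesis unfolding cutD cutA
          by (cases "a \<in> S"; cases "c \<in> S"; cases "d \<in> S"; cases "c' \<in> S"; cases "d' \<in> S"; simp)
      next
        case 2
        then have "d \<in> S \<longleftrightarrow> c \<in> S" "c' \<in> S \<longleftrightarrow> c \<in> S" "d' \<in> S \<longleftrightarrow> c \<in> S" using Y by blast+
        then show ?thesis unfolding cutD cutA
          by (cases "c \<in> S"; cases "a \<in> S"; cases "b \<in> S"; cases "a' \<in> S"; cases "b' \<in> S"; simp)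
      next
        case 3
        from sep[OF \<open>S \<subseteq> V\<close> this] show ?thesis unfolding cutD cutA
          by (cases "a \<in> S"; cases "b \<in> S"; cases "a' \<in> S"; cases "b' \<in> S";
              cases "c \<in> S"; cases "d \<in> S"; cases "c' \<in> S"; cases "d' \<in> S"; simp)
      qed
    qed
    show "card (cut_edges ?D X) < card (cut_edges ?A X)" unfolding cutD cutA using X out by simp
    show "degree ?A v = degree ?D v" for v
      unfolding degD degA by simp
    show "card ?A = card ?D" using ne by simp
    show "col u \<noteq> col v" if "{u, v} \<in> ?A" for u v
      using that col by (auto simp: doubleton_eq_iff)
  qed (use adm edges X new V neq out in auto)
qed

lemma exists_zero_deficiency:
  assumes adm: "admissible V F col dg m G"
    and step: "\<And>G X. admissible V F col dg m G \<Longrightarrow> X \<subseteq> V \<Longrightarrow> X \<noteq> {} \<Longrightarrow> X \<noteq> V \<Longrightarrow>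
       card (cut_edges G X) < k \<Longrightarrow> \<exists>G'. admissible V F col dg m G' \<and> deficiency V k G' < deficiency V k G"
  shows "\<exists>G. admissible V F col dg m G \<and> (\<forall>S\<subseteq>V. S \<noteq> {} \<longrightarrow> S \<noteq> V \<longrightarrow> k \<le> card (cut_edges G S))"
proof -
  obtain G' where G': "admissible V F col dg m G'"
    "\<And>H. admissible V F col dg m H \<Longrightarrow> deficiency V k G' \<le> deficiency V k H"
    using ex_has_least_nat[of "admissible V F col dg m" G "deficiency V k"] adm by blast
  then show ?thesis using step[of G'] by (meson not_le)
qed

section \<open>From cut sizes to edge-connectivity\<close>

lemma edge_connected_if_cuts:
  assumes sg: "simple_graph V E"
    and cuts: "\<And>S. S \<subseteq> V \<Longrightarrow> S \<noteq> {} \<Longrightarrow> S \<noteq> V \<Longrightarrow> k \<le> card (cut_edges E S)"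
  shows "edge_connected k V E"
  unfolding edge_connected_def graph_connected_def
proof (intro allI impI ballI)
  fix F u v assume F: "F \<subseteq> E" "card F < k" and uv: "u \<in> V" "v \<in> V"
  let ?R = "{(x, y). {x, y} \<in> E - F}\<^sup>*"
  \<comment> \<open>The component of \<open>u\<close> after deleting \<open>F\<close>: all edges
    leaving it were deleted, so its cut is too small unless it is all of \<open>V\<close>.\<close>
  define S where "S = {w \<in> V. (u, w) \<in> ?R}"
  have fin: "finite E" using sg by (rule simple_graph_finite)
  have "cut_edges E S \<subseteq> F"
  proof
    fix e assume e: "e \<in> cut_edges E S"
    then have "e \<in> E" by (simp add: cut_edges_def)
    with sg obtain x y where xy: "e = {x, y}" "x \<in> V" "y \<in> V"
      by (rule simple_graph_edge)
    have "(u, y) \<in> ?R" if "(u, x) \<in> ?R" "{x, y} \<in> E - F" for x y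
      using that by (meson CollectI case_prodI rtrancl.rtrancl_into_rtrancl)
    from this[of x y] this[of y x] have "e \<in> E - F \<Longrightarrow> x \<in> S \<longleftrightarrow> y \<in> S"
      using xy unfolding S_def by (auto simp: insert_commute)
    then show "e \<in> F" using e xy \<open>e \<in> E\<close> by (auto simp: doubleton_in_cut_edges)
  qed
  then have "card (cut_edges E S) < k"
    using F fin by (meson card_mono finite_subset le_less_trans)
  moreover have "S \<subseteq> V" "u \<in> S" using uv by (auto simp: S_def)
  ultimately have "S = V" using cuts[of S] by fastforce
  then show "(u, v) \<in> ?R" using uv by (auto simp: S_def)
qed

text \<open>Deleting all edges at a vertex of minimum degree isolates it. Positivity of the minimum
  degree provides a second vertex; on a single vertex every \<open>t\<close> would qualify.\<close>

lemma edge_connected_le_min_degree: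
  assumes sg: "simple_graph V E" and pos: "1 \<le> min_degree V E" and con: "edge_connected t V E"
  shows "t \<le> min_degree V E"
proof (rule ccontr)
  assume less: "\<not> ?thesis"
  have V: "finite V" "V \<noteq> {}" using sg by (auto simp: simple_graph_def)
  then obtain v where v: "v \<in> V" "degree E v = min_degree V E"
    unfolding min_degree_def by (metis (no_types, lifting) Min_in finite_imageI image_iff image_is_empty)
  let ?F = "{e \<in> E. v \<in> e}"
  have "card ?F = min_degree V E" using v(2) by (simp add: degree_def)
  then have "?F \<noteq> {}" "card ?F < t" using pos less by (metis card.empty not_one_le_zero, simp)
  then obtain e where "e \<in> E" "v \<in> e" by blast
  with sg obtain w where w: "w \<in> V" "w \<noteq> v" by (metis simple_graph_edge insertE singletonD)
  have "graph_connected V (E - ?F)"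
    using con \<open>card ?F < t\<close> unfolding edge_connected_def by simp
  then have "\<forall>y\<in>V. (v, y) \<in> {(x, y). {x, y} \<in> E - ?F}\<^sup>*"
    unfolding graph_connected_def using v(1) by (rule bspec)
  then have "(v, w) \<in> {(x, y). {x, y} \<in> E - ?F}\<^sup>*" using w(1) by (rule bspec)
  then show False using w(2) by (cases rule: converse_rtranclE) auto
qed

lemma maximally_edge_connectedI:
  assumes "simple_graph V E" "1 \<le> min_degree V E" "edge_connected (min_degree V E) V E"
  shows "maximally_edge_connected V E"
  unfolding maximally_edge_connected_def edge_connectivity_def
proof (rule Max_eqI)
  show "finite {t. edge_connected t V E}"
    using edge_connected_le_min_degree[OF assms(1,2)] by (auto intro: finite_subset[OF _ finite_atMost])
qed (use assms edge_connected_le_min_degree in auto)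

section \<open>Deficient sets, their interiors and available switches\<close>

lemma degree_le_card_cut_edges:
  assumes sg: "simple_graph V E" and v: "v \<in> X"
    and bd: "\<And>u. {v, u} \<in> E \<Longrightarrow> u \<in> X \<Longrightarrow> \<exists>w. w \<notin> X \<and> {u, w} \<in> E"
  shows "degree E v \<le> card (cut_edges E X)"
proof -
  define N where "N = {u. {v, u} \<in> E}"
  have fin: "finite (cut_edges E X)" using sg by (simp add: finite_cut_edges simple_graph_finite)
  have "\<exists>w. (u \<in> X \<longrightarrow> w \<notin> X \<and> {u, w} \<in> E)" if "u \<in> N" for u
    using bd that by (auto simp: N_def)
  then obtain w where w: "\<And>u. u \<in> N \<Longrightarrow> u \<in> X \<Longrightarrow> w u \<notin> X \<and> {u, w u} \<in> E" by metis
  \<comment> \<open>An injection of the neighbors of \<open>v\<close> into the cut: an inner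
    neighbor is the only end in \<open>X\<close> of its image, and an outer one is sent to its edge
    to \<open>v\<close>, which is not its own neighbor.\<close>
  define f where "f u = (if u \<in> X then {u, w u} else {v, u})" for u
  have vN: "v \<notin> N" using simple_graph_doubleton(1)[OF sg] unfolding N_def by blast
  have "{e \<in> E. v \<in> e} = (\<lambda>u. {v, u}) ` N"
  proof
    show "{e \<in> E. v \<in> e} \<subseteq> (\<lambda>u. {v, u}) ` N"
      using sg unfolding N_def by (fastforce elim: simple_graph_edge simp: insert_commute)
  qed (auto simp: N_def)
  then have "degree E v = card ((\<lambda>u. {v, u}) ` N)" by (simp add: degree_def)
  also have "\<dots> = card N" by (rule card_image) (auto simp: inj_on_def doubleton_eq_iff)
  also have "\<dots> = card (f ` N)"
    using w v vN by (intro card_image[symmetric]) (fastforce simp: inj_on_def f_def doubleton_eq_iff)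
  also have "\<dots> \<le> card (cut_edges E X)"
    using fin w v by (intro card_mono) (auto simp: f_def N_def doubleton_in_cut_edges)
  finally show ?thesis .
qed


lemma minimal_deficient_set:
  assumes "finite X" "X \<noteq> {}" "card (cut_edges G X) < k"
  obtains Y where "Y \<subseteq> X" "Y \<noteq> {}" "card (cut_edges G Y) < k"
    "\<And>T. T \<subset> Y \<Longrightarrow> T \<noteq> {} \<Longrightarrow> k \<le> card (cut_edges G T)"
proof -
  define A where "A = {T \<in> Pow X. T \<noteq> {} \<and> card (cut_edges G T) < k}"
  have "finite A" "X \<in> A" using assms by (auto simp: A_def)
  then obtain Y where Y: "Y \<in> A" "\<And>T. T \<in> A \<Longrightarrow> T \<subseteq> Y \<Longrightarrow> Y = T"
    using finite_has_minimal[of A] by blast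
  have min: "k \<le> card (cut_edges G T)" if T: "T \<subset> Y" "T \<noteq> {}" for T
  proof (rule ccontr)
    assume "\<not> ?thesis"
    then have "T \<in> A" using T Y(1) by (auto simp: A_def)
    then show False using Y(2) T by blast
  qed
  show thesis by (rule that[of Y]) (use Y(1) min in \<open>simp_all add: A_def\<close>)
qed

lemma splitting_minimal_deficient_set:
  assumes sg: "simple_graph V G" and k: "even k"
    and X: "card (cut_edges G X) < k" "\<And>T. T \<subset> X \<Longrightarrow> T \<noteq> {} \<Longrightarrow> k \<le> card (cut_edges G T)"
    and S: "X \<inter> S \<noteq> {}" "X - S \<noteq> {}"
  shows "k + 2 \<le> 2 * card {e \<in> cut_edges G S. e \<subseteq> X}"
proof -
  let ?P = "{e \<in> cut_edges G S. e \<subseteq> X}"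
  \<comment> \<open>The edges leaving \<open>X\<close> are sorted by whether their end in
    \<open>X\<close> lies in \<open>S\<close>. The edges in \<open>?P\<close> may leave both parts
    of \<open>X\<close>, hence the factor 2.\<close>
  let ?Q1 = "{e \<in> cut_edges G X. e \<inter> X \<subseteq> S}"
  let ?Q2 = "{e \<in> cut_edges G X. \<not> e \<inter> X \<subseteq> S}"
  have fin: "finite (cut_edges G T)" for T using sg by (simp add: finite_cut_edges simple_graph_finite)
  have "cut_edges G (X \<inter> S) \<subseteq> ?P \<union> ?Q1 \<and> cut_edges G (X - S) \<subseteq> ?P \<union> ?Q2"
  proof (intro conjI subsetI)
    fix e
    assume e: "e \<in> cut_edges G (X \<inter> S)"
    then have "e \<in> G" by (simp add: cut_edges_def)
    with sg obtain u v where "e = {u, v}" by (rule simple_graph_edge)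
    with e show "e \<in> ?P \<union> ?Q1" by (auto simp: doubleton_in_cut_edges)
  next
    fix e
    assume e: "e \<in> cut_edges G (X - S)"
    then have "e \<in> G" by (simp add: cut_edges_def)
    with sg obtain u v where "e = {u, v}" by (rule simple_graph_edge)
    with e show "e \<in> ?P \<union> ?Q2" by (auto simp: doubleton_in_cut_edges)
  qed
  then have "card (cut_edges G (X \<inter> S)) \<le> card (?P \<union> ?Q1) \<and>
      card (cut_edges G (X - S)) \<le> card (?P \<union> ?Q2)"
    using fin by (intro conjI card_mono) simp_all
  then have "card (cut_edges G (X \<inter> S)) \<le> card ?P + card ?Q1"
    "card (cut_edges G (X - S)) \<le> card ?P + card ?Q2"
    using card_Un_le[of ?P ?Q1] card_Un_le[of ?P ?Q2] by linarith+
  moreover have "card (cut_edges G X) = card ?Q1 + card ?Q2"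
  proof -
    have "cut_edges G X = ?Q1 \<union> ?Q2" by blast
    moreover have "card (?Q1 \<union> ?Q2) = card ?Q1 + card ?Q2"
      by (rule card_Un_disjoint) (use fin in auto)
    ultimately show ?thesis by simp
  qed
  moreover have "k \<le> card (cut_edges G (X \<inter> S))" "k \<le> card (cut_edges G (X - S))"
    by (rule X(2); use S in blast)+
  ultimately have "k < 2 * card ?P" using X(1) by linarith
  then show ?thesis using k by presburger
qed

text \<open>Were the interior monochromatic, no inner neighbor of an interior vertex
  \<open>v\<close> would be interior, by properness; if the interior is empty, this holds for any
  \<open>v\<close> in \<open>X\<close>. Then \<open>degree_le_card_cut_edges\<close> bounds the
  degree of \<open>v\<close> by the cut, which is smaller than \<open>k\<close>.\<close>

lemma interior_two_colours:
  assumes adm: "admissible V F col dg m G" and X: "X \<subseteq> V" "X \<noteq> {}" "card (cut_edges G X) < k"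
    and deg: "\<And>v. v \<in> V \<Longrightarrow> k \<le> dg v"
  obtains a a' where "a \<in> X" "a' \<in> X" "col a \<noteq> col a'"
    "\<And>u. {a, u} \<in> G \<Longrightarrow> u \<in> X" "\<And>u. {a', u} \<in> G \<Longrightarrow> u \<in> X"
proof (rule ccontr)
  let ?I = "{v \<in> X. \<forall>u. {v, u} \<in> G \<longrightarrow> u \<in> X}"
  assume "\<not> thesis"
  with that have mono: "col a = col a'" if "a \<in> ?I" "a' \<in> ?I" for a a'
    using that by blast
  obtain v where v: "v \<in> X" "?I \<noteq> {} \<Longrightarrow> v \<in> ?I" using X(2) by blast
  have "\<exists>w. w \<notin> X \<and> {u, w} \<in> G" if "{v, u} \<in> G" "u \<in> X" for u
  proof (rule ccontr)
    assume "\<not> ?thesis"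
    then have "u \<in> ?I" using that by blast
    then show False using v mono that adm unfolding admissible_def by blast
  qed
  then have "degree G v \<le> card (cut_edges G X)"
    using degree_le_card_cut_edges[OF _ v(1)] adm unfolding admissible_def by blast
  moreover have "v \<in> V" using v(1) X(1) by blast
  moreover from this have "degree G v = dg v" using adm by (simp add: admissible_def)
  ultimately show False using deg[of v] X(3) by simp
qed

text \<open>Every vertex keeps an exchangeable edge throughout the descent, because only its degree
  in \<open>G\<close>, not its neighborhood, is preserved by exchanges.\<close>

lemma free_edge:
  assumes adm: "admissible V F col dg m G" and "v \<in> V" "degree F v < dg v"
  obtains u where "{v, u} \<in> G - F"
proof -
  have sg: "simple_graph V G" using adm by (simp add: admissible_def)
  have "\<not> {e \<in> G. v \<in> e} \<subseteq> {e \<in> F. v \<in> e}"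
  proof
    assume "{e \<in> G. v \<in> e} \<subseteq> {e \<in> F. v \<in> e}"
    moreover have "F \<subseteq> G" using adm by (simp add: admissible_def)
    ultimately have "{e \<in> G. v \<in> e} = {e \<in> F. v \<in> e}" by blast
    then have "degree G v = degree F v" by (simp add: degree_def)
    then show False using adm assms(2,3) by (simp add: admissible_def)
  qed
  then obtain e where e: "e \<in> G - F" "v \<in> e" by blast
  then obtain x y where "e = {x, y}" using sg by (metis DiffD1 simple_graph_edge)
  then show thesis using e that by (metis doubleton_eq_iff insertE singletonD)
qed

text \<open>The edges can be replaced by \<open>ac\<close>, \<open>bd\<close> or by
  \<open>ad\<close>, \<open>bc\<close>. If the colors forbid the second pair, properness at
  \<open>ab\<close> and \<open>cd\<close> makes the first pair admissible, and only adjacency of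
  \<open>b\<close> and \<open>d\<close> can block it.\<close>

lemma coloured_two_switch:
  assumes adm: "admissible V F col dg m G"
    and edges: "{a, b} \<in> G - F" "{c, d} \<in> G - F"
    and X: "a \<in> X" "b \<in> X" "c \<notin> X" "d \<notin> X" "X \<subseteq> V" "card (cut_edges G X) < k"
    and new: "{a, c} \<notin> G" "{a, d} \<notin> G" "{b, c} \<notin> G"
    and bd: "\<not> ({b, d} \<in> G \<and> (col a = col d \<or> col b = col c))"
    and sep: "\<And>S. S \<subseteq> V \<Longrightarrow> (a \<in> S) \<noteq> (b \<in> S) \<Longrightarrow> (c \<in> S) \<noteq> (d \<in> S) \<Longrightarrow>
                 k + 2 \<le> card (cut_edges G S)"
  shows "\<exists>G'. admissible V F col dg m G' \<and> deficiency V k G' < deficiency V k G"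
proof (cases "col a = col d \<or> col b = col c")
  case True
  have "col a \<noteq> col b" "col c \<noteq> col d" using adm edges unfolding admissible_def by blast+
  then have "col a \<noteq> col c" "col b \<noteq> col d" using True by auto
  then show ?thesis using two_switch[OF adm edges X new(1) _ _ _ sep] True bd by blast
next
  case False
  have "{d, c} \<in> G - F" using edges by (simp add: insert_commute)
  then show ?thesis
    using two_switch[OF adm edges(1) _ X(1,2,4,3,5,6) new(2,3) _ _ sep] False by auto
qed

section \<open>The descent for even \<open>k\<close>\<close>

lemma reduce_deficiency_even:
  assumes adm: "admissible V F col dg m G" and k: "even k"
    and degF: "\<And>v. v \<in> V \<Longrightarrow> degree F v < dg v" and deg: "\<And>v. v \<in> V \<Longrightarrow> k \<le> dg v"
    and X0: "X0 \<subseteq> V" "X0 \<noteq> {}" "X0 \<noteq> V" "card (cut_edges G X0) < k"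
  shows "\<exists>G'. admissible V F col dg m G' \<and> deficiency V k G' < deficiency V k G"
proof (rule ccontr)
  assume stuck: "\<not> ?thesis"
  have sg: "simple_graph V G" and proper: "\<And>u v. {u, v} \<in> G \<Longrightarrow> col u \<noteq> col v"
    using adm by (auto simp: admissible_def)
  have finV: "finite V" using sg by (simp add: simple_graph_def)
  have fin: "finite (cut_edges G S)" for S using sg by (simp add: finite_cut_edges simple_graph_finite)
  obtain X where X: "X \<subseteq> X0" "X \<noteq> {}" "card (cut_edges G X) < k"
    "\<And>T. T \<subset> X \<Longrightarrow> T \<noteq> {} \<Longrightarrow> k \<le> card (cut_edges G T)"
    using minimal_deficient_set[of X0 G k, OF finite_subset[OF X0(1) finV] X0(2,4)] by blast
  have XV: "X \<subseteq> V" "V - X \<noteq> {}" using X X0 by auto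
  obtain Y where Y: "Y \<subseteq> V - X" "Y \<noteq> {}" "card (cut_edges G Y) < k"
    "\<And>T. T \<subset> Y \<Longrightarrow> T \<noteq> {} \<Longrightarrow> k \<le> card (cut_edges G T)"
    using minimal_deficient_set[of "V - X" G k] X(3) XV(2) finV
    unfolding cut_edges_complement[OF sg] by blast
  have YV: "Y \<subseteq> V" "X \<inter> Y = {}" using Y(1) by auto
  \<comment> \<open>\<open>X\<close> and \<open>Y\<close> each contribute at least
    \<open>k / 2 + 1\<close> cut edges. The edges inside neither are counted separately to pay for a
    loss of four.\<close>
  have sep: "k + 2 + card {e \<in> cut_edges G S. \<not> e \<subseteq> X \<and> \<not> e \<subseteq> Y} \<le> card (cut_edges G S)"
    if S: "X \<inter> S \<noteq> {}" "X - S \<noteq> {}" "Y \<inter> S \<noteq> {}" "Y - S \<noteq> {}" for S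
  proof -
    let ?C = "cut_edges G S"
    let ?PX = "{e \<in> ?C. e \<subseteq> X}" and ?PY = "{e \<in> ?C. e \<subseteq> Y}" and ?R = "{e \<in> ?C. \<not> e \<subseteq> X \<and> \<not> e \<subseteq> Y}"
    have "e \<noteq> {}" if "e \<in> ?C" for e using that by (auto simp: cut_edges_def)
    then have disj: "?PX \<inter> ?PY = {}" using YV by blast
    have "card ?C = card (?PX \<union> ?PY \<union> ?R)" by (rule arg_cong[of _ _ card]) blast
    also have "\<dots> = card (?PX \<union> ?PY) + card ?R" by (rule card_Un_disjoint) (use fin in auto)
    also have "card (?PX \<union> ?PY) = card ?PX + card ?PY"
      by (rule card_Un_disjoint) (use fin disj in auto)
    finally show ?thesis
      using splitting_minimal_deficient_set[OF sg k X(3,4) S(1,2)]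
        splitting_minimal_deficient_set[OF sg k Y(3,4) S(3,4)] by simp
  qed
  have sep': "k + 2 \<le> card (cut_edges G S)"
    if "a \<in> X" "b \<in> X" "c \<in> Y" "d \<in> Y" "(a \<in> S) \<noteq> (b \<in> S)" "(c \<in> S) \<noteq> (d \<in> S)" for S a b c d
  proof -
    have "X \<inter> S \<noteq> {}" "X - S \<noteq> {}" "Y \<inter> S \<noteq> {}" "Y - S \<noteq> {}" using that by blast+
    from sep[OF this] show ?thesis by simp
  qed
  have bad: "{b, d} \<in> G \<and> (col a = col d \<or> col b = col c)"
    if "a \<in> X" "\<And>u. {a, u} \<in> G \<Longrightarrow> u \<in> X" "c \<in> Y" "\<And>u. {c, u} \<in> G \<Longrightarrow> u \<in> Y"
      "{a, b} \<in> G - F" "{c, d} \<in> G - F" for a b c d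
  proof -
    have b: "b \<in> X" and d: "d \<in> Y" using that by auto
    have out: "c \<notin> X" "d \<notin> X" "b \<notin> Y" using that(3) b d YV by auto
    have "{a, c} \<notin> G" "{a, d} \<notin> G" "{b, c} \<notin> G"
      using that(2,4) out by (auto simp: insert_commute)
    then show ?thesis
      using coloured_two_switch[OF adm that(5,6,1) b out(1,2) XV(1) X(3)] sep' b d that(1,3) stuck
      by blast
  qed
  obtain a a' where a: "a \<in> X" "a' \<in> X" "col a \<noteq> col a'"
    "\<And>u. {a, u} \<in> G \<Longrightarrow> u \<in> X" "\<And>u. {a', u} \<in> G \<Longrightarrow> u \<in> X"
    using interior_two_colours[OF adm XV(1) X(2,3) deg] by metis
  obtain b b' where b: "{a, b} \<in> G - F" "{a', b'} \<in> G - F"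
    using free_edge[OF adm _ degF] a(1,2) XV(1) by (metis subsetD)
  obtain c0 c0' where c0: "c0 \<in> Y" "c0' \<in> Y" "col c0 \<noteq> col c0'"
    "\<And>u. {c0, u} \<in> G \<Longrightarrow> u \<in> Y" "\<And>u. {c0', u} \<in> G \<Longrightarrow> u \<in> Y"
    using interior_two_colours[OF adm YV(1) Y(2,3) deg] by metis
  obtain d0 d0' where d0: "{c0, d0} \<in> G - F" "{c0', d0'} \<in> G - F"
    using free_edge[OF adm _ degF] c0(1,2) YV(1) by (metis subsetD)
  \<comment> \<open>Up to swapping the two interior vertices of \<open>Y\<close>, the color conflict is \<open>col a = col d\<close>.\<close>
  obtain c c' d d' where c: "c \<in> Y" "c' \<in> Y" "col c \<noteq> col c'"
    "\<And>u. {c, u} \<in> G \<Longrightarrow> u \<in> Y" "\<And>u. {c', u} \<in> G \<Longrightarrow> u \<in> Y"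
    and d: "{c, d} \<in> G - F" "{c', d'} \<in> G - F" and ad: "col a = col d"
  proof (cases "col a = col d0")
    case True
    with c0 d0 show thesis using that by blast
  next
    case False
    then have "col b = col c0" using bad[OF a(1,4) c0(1,4) b(1) d0(1)] by blast
    then have "col a = col d0'" using bad[OF a(1,4) c0(2,5) b(1) d0(2)] c0(3) by auto
    with c0 d0 show thesis using that[of c0' c0 d0' d0] by auto
  qed
  note bad4 = bad[OF a(1,4) c(1,4) b(1) d(1)] bad[OF a(1,4) c(2,5) b(1) d(2)]
    bad[OF a(2,5) c(1,4) b(2) d(1)] bad[OF a(2,5) c(2,5) b(2) d(2)]
  have p: "col a \<noteq> col b" "col a' \<noteq> col b'" "col c \<noteq> col d" "col c' \<noteq> col d'"
    "col b \<noteq> col d" "col b \<noteq> col d'" "col b' \<noteq> col d" "col b' \<noteq> col d'"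
    using proper b d bad4 by blast+
  \<comment> \<open>The conflicts are resolved in turn: \<open>col a' \<noteq> col d\<close> forces
    \<open>col b' = col c\<close>; this differs from \<open>col c'\<close>, forcing
    \<open>col a' = col d'\<close>; hence \<open>col a \<noteq> col d'\<close>, forcing
    \<open>col b = col c'\<close>.\<close>
  have cols: "col b' = col c" "col a' = col d'" "col b = col c'"
    using bad4 a(3) c(3) p ad by metis+
  have inX: "b \<in> X" "b' \<in> X" and inY: "d \<in> Y" "d' \<in> Y" using a b c d by auto
  have out: "b \<notin> Y" "b' \<notin> Y" "d \<notin> X" "d' \<notin> X" using inX inY YV by auto
  have "\<exists>G'. admissible V F col dg m G' \<and> deficiency V k G' < deficiency V k G"
  proof (rule four_switch[OF adm b(1) d(1) b(2) d(2) a(1) inX(1) a(2) inX(2) XV(1) X(3)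
        c(1) inY(1) c(2) inY(2)])
    show "Y \<inter> X = {}" using YV by blast
    \<comment> \<open>All of \<open>b\<close>, \<open>b'\<close>, \<open>d\<close>,
      \<open>d'\<close> have neighbors across, so none of them is an interior vertex of its
      side.\<close>
    have "{b', d} \<in> G" "{b, d} \<in> G" "{d', b} \<in> G" "{d, b} \<in> G"
      using bad4 by (simp_all add: insert_commute)
    then have "a \<noteq> b'" "a' \<noteq> b" "c \<noteq> d'" "c' \<noteq> d"
      using a(4)[of d] a(5)[of d] c(4)[of b] c(5)[of b] out by auto
    moreover have neq: "b \<noteq> b'" "d \<noteq> d'" "a \<noteq> a'" "c \<noteq> c'" using cols ad a(3) c(3) by metis+
    moreover have "a \<noteq> b" "a' \<noteq> b'" "c \<noteq> d" "c' \<noteq> d'" using p by blast+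
    ultimately show "distinct [a, b, a', b']" "distinct [c, d, c', d']" by auto
    show "{b, c} \<notin> G" "{d, a'} \<notin> G" "{b', c'} \<notin> G" "{d', a} \<notin> G"
      using a(4,5) c(4,5) out by (metis insert_commute)+
    show "col b \<noteq> col c" "col d \<noteq> col a'" "col b' \<noteq> col c'" "col d' \<noteq> col a"
      using cols ad a(3) c(3) by auto
    fix S assume S: "X \<inter> S \<noteq> {}" "X - S \<noteq> {}" "Y \<inter> S \<noteq> {}" "Y - S \<noteq> {}"
    \<comment> \<open>The blocking edges \<open>bd\<close> and \<open>b'd'\<close> run between
      \<open>X\<close> and \<open>Y\<close>, so they are the additional cut edges that
      \<open>four_switch\<close> requires.\<close>
    have "2 \<le> card {e \<in> cut_edges G S. \<not> e \<subseteq> X \<and> \<not> e \<subseteq> Y}"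
      if "(b \<in> S) \<noteq> (d \<in> S)" "(b' \<in> S) \<noteq> (d' \<in> S)"
    proof -
      have "{b, d} \<noteq> {b', d'}" using neq inX out by (auto simp: doubleton_eq_iff)
      then have "2 = card {{b, d}, {b', d'}}" by simp
      also have "\<dots> \<le> card {e \<in> cut_edges G S. \<not> e \<subseteq> X \<and> \<not> e \<subseteq> Y}"
        using fin that bad4 out by (intro card_mono) (auto simp: doubleton_in_cut_edges)
      finally show ?thesis .
    qed
    then show "k + 2 + (if (b \<in> S) \<noteq> (d \<in> S) \<and> (b' \<in> S) \<noteq> (d' \<in> S) then 2 else 0)
        \<le> card (cut_edges G S)"
      using sep[OF S] by auto
  qed
  then show False using stuck by blast
qed

section \<open>The descent for \<open>k = 1\<close>\<close>

lemma card_le_if_all_bridges: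
  assumes "finite V" "V \<noteq> {}" "\<And>e. e \<in> Z \<Longrightarrow> e \<subseteq> V \<and> card e = 2"
    "\<And>e. e \<in> Z \<Longrightarrow> \<exists>S. cut_edges Z S = {e}"
  shows "card Z + 1 \<le> card V"
  using assms
proof (induction V arbitrary: Z rule: finite_psubset_induct)
  case (psubset V)
  show ?case
  proof (cases "Z = {}")
    case True
    then show ?thesis using psubset by (simp add: Suc_le_eq card_gt_0_iff)
  next
    case False
    \<comment> \<open>A one-edge cut says that \<open>e\<close> is a bridge, so this is the edge
      bound for forests. Removing \<open>e\<close> splits the graph into its parts on
      \<open>V \<inter> S\<close> and \<open>V - S\<close>, both nonempty; bridges stay bridges in
      subgraphs containing them.\<close>
    then obtain e S where e: "e \<in> Z" "cut_edges Z S = {e}" using psubset.prems(3) by blast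
    let ?Z = "\<lambda>U. {f \<in> Z. f \<subseteq> U}"
    have "e \<in> cut_edges Z S" using e(2) by simp
    then have ecut: "e \<inter> S \<noteq> {}" "\<not> e \<subseteq> S" by (simp_all add: cut_edges_def)
    have eV: "e \<subseteq> V" using e(1) psubset.prems(2) by simp
    have IH: "card (?Z U) + 1 \<le> card U" if "U \<subset> V" "U \<noteq> {}" for U
    proof (rule psubset.IH[OF that])
      show "\<exists>S. cut_edges (?Z U) S = {f}" if "f \<in> ?Z U" for f
      proof -
        obtain S where "cut_edges Z S = {f}" using psubset.prems(3) \<open>f \<in> ?Z U\<close> by blast
        then have "cut_edges (?Z U) S = {f}" using \<open>f \<in> ?Z U\<close> unfolding cut_edges_def by blast
        then show ?thesis by blast
      qed
    qed (use psubset.prems(2) that(2) in simp_all)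
    have split: "f = e \<or> f \<subseteq> V \<inter> S \<or> f \<subseteq> V - S" if "f \<in> Z" for f
    proof -
      have "f \<subseteq> V" using psubset.prems(2) that by simp
      moreover have "f \<in> cut_edges Z S \<or> f \<inter> S = {} \<or> f \<subseteq> S" using that by (auto simp: cut_edges_def)
      ultimately show ?thesis using e(2) by blast
    qed
    have "card Z = card (insert e (?Z (V \<inter> S) \<union> ?Z (V - S)))"
      by (rule arg_cong[of _ _ card]) (use split e(1) in blast)
    moreover have "card (insert e B) \<le> Suc (card B)" for B
      by (cases "finite B") (simp_all add: card_insert_if)
    ultimately have "card Z \<le> Suc (card (?Z (V \<inter> S) \<union> ?Z (V - S)))" by simp
    also have "\<dots> \<le> Suc (card (?Z (V \<inter> S)) + card (?Z (V - S)))" by (simp add: card_Un_le)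
    finally have "card Z \<le> Suc (card (?Z (V \<inter> S)) + card (?Z (V - S)))" .
    moreover have "card (?Z (V \<inter> S)) + 1 \<le> card (V \<inter> S)" "card (?Z (V - S)) + 1 \<le> card (V - S)"
      by (rule IH; use ecut eV in blast)+
    moreover have "card V = card (V \<inter> S) + card (V - S)"
      using psubset.hyps by (metis card_Int_Diff)
    ultimately show ?thesis by linarith
  qed
qed

lemma reduce_deficiency_one:
  assumes adm: "admissible V F col dg m G"
    and degF: "\<And>v. v \<in> V \<Longrightarrow> degree F v < dg v" and m: "card F + card V \<le> m + 1"
    and X: "X \<subseteq> V" "X \<noteq> {}" "X \<noteq> V" "card (cut_edges G X) < 1"
  shows "\<exists>G'. admissible V F col dg m G' \<and> deficiency V 1 G' < deficiency V 1 G"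
proof -
  have sg: "simple_graph V G" and FG: "F \<subseteq> G" and proper: "\<And>u v. {u, v} \<in> G \<Longrightarrow> col u \<noteq> col v"
    and cardG: "card G = m"
    using adm by (auto simp: admissible_def)
  have finV: "finite V" using sg by (simp add: simple_graph_def)
  have finG: "finite G" using sg by (rule simple_graph_finite)
  have fin: "finite (cut_edges G S)" for S using finG by (simp add: finite_cut_edges)
  let ?Z = "G - F"
  have closed: "e \<subseteq> X \<or> e \<subseteq> V - X" if "e \<in> G" for e
    using X(4) fin[of X] sg that unfolding simple_graph_def cut_edges_def by auto
  \<comment> \<open>If all edges of \<open>G - F\<close> were bridges, the forest bound on
    \<open>X\<close> and on \<open>V - X\<close> would leave at most \<open>card V - 2\<close> of
    them, one fewer than \<open>m\<close> guarantees.\<close>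
  have "\<exists>e \<in> ?Z. \<forall>S. cut_edges G S \<noteq> {e}"
  proof (rule ccontr)
    assume "\<not> ?thesis"
    then have br: "\<exists>S. cut_edges G S = {e}" if "e \<in> ?Z" for e using that by blast
    have le: "card {e \<in> ?Z. e \<subseteq> U} + 1 \<le> card U" if "U \<subseteq> V" "U \<noteq> {}" for U
    proof (rule card_le_if_all_bridges)
      show "\<exists>S. cut_edges {e \<in> ?Z. e \<subseteq> U} S = {f}" if f: "f \<in> {e \<in> ?Z. e \<subseteq> U}" for f
      proof -
        obtain S where "cut_edges G S = {f}" using br f by blast
        then have "cut_edges {e \<in> ?Z. e \<subseteq> U} S = {f}" using f unfolding cut_edges_def by blast
        then show ?thesis by blast
      qed
    qed (use that(2) finite_subset[OF that(1) finV] sg in \<open>simp_all add: simple_graph_def\<close>)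
    have "card ?Z = card ({e \<in> ?Z. e \<subseteq> X} \<union> {e \<in> ?Z. e \<subseteq> V - X})"
      by (rule arg_cong[of _ _ card]) (use closed in blast)
    also have "\<dots> \<le> card {e \<in> ?Z. e \<subseteq> X} + card {e \<in> ?Z. e \<subseteq> V - X}" by (rule card_Un_le)
    finally have "card ?Z \<le> card {e \<in> ?Z. e \<subseteq> X} + card {e \<in> ?Z. e \<subseteq> V - X}" .
    moreover have "card V = card X + card (V - X)" using finV X(1)
      by (metis card_Int_Diff inf.absorb_iff2)
    moreover have "card {e \<in> ?Z. e \<subseteq> X} + 1 \<le> card X" "card {e \<in> ?Z. e \<subseteq> V - X} + 1 \<le> card (V - X)"
      using le X by auto
    moreover have "card ?Z = m - card F" using FG finG cardG by (metis card_Diff_subset finite_subset)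
    ultimately show False using m by linarith
  qed
  then obtain e where e: "e \<in> ?Z" "\<And>S. cut_edges G S \<noteq> {e}" by blast
  obtain W where W: "W \<subseteq> V" "W \<noteq> {}" "W \<noteq> V" "card (cut_edges G W) < 1" "e \<subseteq> W"
  proof (cases "e \<subseteq> X")
    case True
    with X that show thesis by blast
  next
    case False
    then have "e \<subseteq> V - X" using closed e(1) by blast
    with X that[of "V - X"] cut_edges_complement[OF sg] show thesis by auto
  qed
  have closedW: "f \<subseteq> W \<or> f \<subseteq> V - W" if "f \<in> G" for f
    using W(4) fin[of W] sg that unfolding simple_graph_def cut_edges_def by auto
  obtain a b where ab: "e = {a, b}" using e(1) sg by (metis DiffD1 simple_graph_edge)
  obtain c where c: "c \<in> V - W" using W by blast
  then obtain d where d: "{c, d} \<in> ?Z" using free_edge[OF adm _ degF] by blast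
  have nonadj: "{x, y} \<notin> G" if "x \<in> W" "y \<notin> W" for x y using closedW that by blast
  have outW: "c \<notin> W" "d \<notin> W" using c d closedW[of "{c, d}"] by auto
  have sep: "1 + 2 \<le> card (cut_edges G S)" if "(a \<in> S) \<noteq> (b \<in> S)" "(c \<in> S) \<noteq> (d \<in> S)" for S
  proof -
    \<comment> \<open>Cutting with \<open>W \<inter> S\<close> instead of \<open>S\<close> puts the
      second cut edge \<open>f\<close> inside \<open>W\<close>, hence away from \<open>cd\<close>;
      the cut of \<open>S\<close> thus has three edges.\<close>
    have "e \<in> cut_edges G (W \<inter> S)" using that e(1) W(5) ab by (auto simp: doubleton_in_cut_edges)
    then obtain f where f: "f \<in> cut_edges G (W \<inter> S)" "f \<noteq> e" using e(2) by blast
    have fW: "f \<subseteq> W" using f(1) closedW[of f] unfolding cut_edges_def by blast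
    then have "f \<in> cut_edges G S" using f(1) unfolding cut_edges_def by blast
    moreover have "e \<in> cut_edges G S" "{c, d} \<in> cut_edges G S"
      using that e(1) d ab by (auto simp: doubleton_in_cut_edges)
    moreover have "card {e, f, {c, d}} = 3"
    proof -
      have "f \<noteq> {c, d}" "e \<noteq> {c, d}" using fW W(5) outW by auto
      then show ?thesis using f(2) by simp
    qed
    ultimately show ?thesis using fin[of S] card_mono[of "cut_edges G S" "{e, f, {c, d}}"] by auto
  qed
  show ?thesis
    by (rule coloured_two_switch[where a = a and b = b and c = c and d = d and X = W])
      (use adm e(1) d W ab outW nonadj sep in auto)
qed

section \<open>Choice of \<open>k\<close> and conclusion\<close>

theorem theorem7:
  fixes V :: "'a set" and G0 Z0 :: "'a set set" and l :: nat
  assumes "simple_graph V G0"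
    and "equitably_colorable l V G0"
    and "Z0 \<subseteq> G0"
    and "min_degree V Z0 \<ge> 1"
    and "min_degree V G0 = 1 \<Longrightarrow> card Z0 \<ge> card V - 1"
  shows "\<exists>G \<in> realizations V (degree G0) (G0 - Z0).
           equitably_colorable l V G \<and>
           (if min_degree V G \<ge> 3 \<and> odd (min_degree V G)
            then edge_connected (min_degree V G - 1) V G
            else maximally_edge_connected V G)"
proof -
  obtain col where col: "proper_coloring l V G0 col" "equitable l V col"
    using assms(2) by (auto simp: equitably_colorable_def)
  define F where "F = G0 - Z0"
  define m where "m = card G0"
  define \<delta> where "\<delta> = min_degree V G0"
  let ?adm = "admissible V F col (degree G0) m"
  have V: "finite V" "V \<noteq> {}" using assms(1) by (auto simp: simple_graph_def)
  have fin: "finite G0" using assms(1) by (rule simple_graph_finite)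
  have adm0: "?adm G0"
    using assms(1) col(1) unfolding admissible_def F_def m_def proper_coloring_def by blast
  have Z0: "1 \<le> degree Z0 v" if "v \<in> V" for v
    using assms(4) V that unfolding min_degree_def by (metis Min_le finite_imageI imageI order_trans)
  have split: "degree G0 v = degree F v + degree Z0 v" for v
  proof -
    have "{e \<in> G0. v \<in> e} = {e \<in> F. v \<in> e} \<union> {e \<in> Z0. v \<in> e}" using assms(3) by (auto simp: F_def)
    moreover have "{e \<in> F. v \<in> e} \<inter> {e \<in> Z0. v \<in> e} = {}" by (auto simp: F_def)
    moreover have "finite F" "finite Z0" using fin assms(3) finite_subset by (auto simp: F_def)
    ultimately show ?thesis unfolding degree_def by (simp add: card_Un_disjoint)
  qed
  have degF: "degree F v < degree G0 v" if "v \<in> V" for v using split[of v] Z0[OF that] by simp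
  have deg: "\<delta> \<le> degree G0 v" if "v \<in> V" for v
    using V that unfolding \<delta>_def min_degree_def by simp
  have "\<exists>v\<in>V. degree G0 v = \<delta>"
    using V unfolding \<delta>_def min_degree_def by (metis (no_types, lifting) Min_in finite_imageI image_iff image_is_empty)
  then have pos: "1 \<le> \<delta>" using degF by force
  have minG: "min_degree V G = \<delta>" if "?adm G" for G
    using that unfolding admissible_def min_degree_def \<delta>_def by (metis (mono_tags, lifting) image_cong)
  have real: "G \<in> realizations V (degree G0) (G0 - Z0) \<and> equitably_colorable l V G" if "?adm G" for G
    using that col unfolding admissible_def realizations_def equitably_colorable_def
      proper_coloring_def F_def by blast
  \<comment> \<open>An odd minimum degree of at least 3 is lowered to an even number; the only odd
    value left is 1, which has its own descent.\<close>
  define k where "k = (if \<delta> \<ge> 3 \<and> odd \<delta> then \<delta> - 1 else \<delta>)"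
  have "\<exists>G. ?adm G \<and> (\<forall>S\<subseteq>V. S \<noteq> {} \<longrightarrow> S \<noteq> V \<longrightarrow> k \<le> card (cut_edges G S))"
  proof (cases "\<delta> = 1")
    case True
    have "card G0 = card F + card Z0"
      using fin assms(3) unfolding F_def by (metis card_Diff_subset card_mono finite_subset le_add_diff_inverse2)
    then have m: "card F + card V \<le> m + 1"
      using assms(5) True unfolding \<delta>_def m_def by simp
    show ?thesis
      using exists_zero_deficiency[OF adm0, of 1] reduce_deficiency_one[OF _ degF m] True
      unfolding k_def by simp
  next
    case False
    then have "even k" using pos unfolding k_def by presburger
    moreover have "k \<le> degree G0 v" if "v \<in> V" for v using deg[OF that] unfolding k_def by auto
    ultimately show ?thesis
      using exists_zero_deficiency[OF adm0, of k] reduce_deficiency_even[OF _ _ degF] by blast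
  qed
  then obtain G where G: "?adm G" "\<And>S. S \<subseteq> V \<Longrightarrow> S \<noteq> {} \<Longrightarrow> S \<noteq> V \<Longrightarrow> k \<le> card (cut_edges G S)"
    by blast
  have sg: "simple_graph V G" using G(1) by (simp add: admissible_def)
  then have "edge_connected k V G" using G(2) by (rule edge_connected_if_cuts)
  then show ?thesis
    using real[OF G(1)] minG[OF G(1)] maximally_edge_connectedI[OF sg] pos
    unfolding k_def by (intro bexI[of _ G]) auto
qed

end
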